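(* Let $\mathbf S^{f,l-1}$ be the fine approximation at level $l-1$ (step $\Delta t$) and let $\mathbf S^{c,l}$ be the coarse approximation at level $l$ (step $\Delta t$), as defined in the context. Then $$\mathbb E\left[\mathbf S^{f,l-1}_n\right]=\mathbb E\left[\mathbf S^{c,l}_n\right]\qquad\text{for each } n=0,1,2,3,\dots$$
   Context: Setting: $a_i,b_{ij}:\mathbb R^d\times[0,\infty)\to\mathbb R$ ($1\le i\le d$, $1\le j\le D$) are the coefficients of the SDE system $dS_i=a_i(\mathbf S,t)\,dt+\sum_{j=1}^D b_{ij}(\mathbf S,t)\,dW_j$, $\mathbf S(0)=\mathbf S_0\in\mathbb R^d$ (deterministic), where $W$ is a $D$-dimensional Brownian motion with correlation matrix $\Omega=(\Omega_{jk})$ (so $\Omega_{jj}=1$ and increments over a time interval of length $s$ are centered Gaussian with covariance $s\,\Omega$). Put $$h_{ijk}=\tfrac12\sum_{r=1}^d b_{rk}\,\frac{\partial b_{ij}}{\partial x_r}.$$ Standing assumption: $a_i$, $b_{ij}$, $h_{ijk}$ have uniformly bounded first derivatives (with respect to all their arguments). Time steps: fix $T>0$ and an integer level $l\ge1$; $\delta t=h_l=T2^{-l}$, $\Delta t=2\delta t=h_{l-1}$, $t_n=n\Delta t$ (also for half-integer $n$). For $n\in\{0,\tfrac12,1,\tfrac32,\dots\}$ let $\delta W_n=W(t_{n+1/2})-W(t_n)$ with components $\delta W_{j,n}$, and for integer $n$ let $\Delta W_n=\delta W_n+\delta W_{n+1/2}$ with components $\Delta W_{j,n}$. One-step increments: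 for a step size $s$ and increment vector $w\in\mathbb R^D$, $$D^f_i(\mathbf S,t,s,w)=a_i(\mathbf S,t)s+\sum_{j=1}^D b_{ij}(\mathbf S,t)w_j+\sum_{j,k=1}^D h_{ijk}(\mathbf S,t)\,(w_jw_k-\Omega_{jk}s),$$ and, for $w,w'\in\mathbb R^D$ and $v=w+w'$, $$D^c_i(\mathbf S_1,\mathbf S_2,t,s,w,w')=a_i(\mathbf S_1,t)s+\sum_{j=1}^D b_{ij}(\mathbf S_2,t)v_j+\sum_{j,k=1}^D h_{ijk}(\mathbf S_2,t)\,(v_jv_k-\Omega_{jk}s-w_jw'_k+w'_jw_k).$$ $\mathbf D^f,\mathbf D^c$ denote the vectors with components $D_i^f,D_i^c$. Schemes (all started at $\mathbf S_0$), for integers $n\ge0$: - level-$(l-1)$ fine: $\mathbf S^{f,l-1}_{n+1}=\mathbf S^{f,l-1}_n+\mathbf D^f(\mathbf S^{f,l-1}_n,t_n,\Delta t,\Delta W_n)$; - level-$l$ starred: $\mathbf S^{*,l}_{n+1}=\mathbf S^{*,l}_n+\mathbf D^f(\mathbf S^{*,l}_n,t_n,\Delta t,\Delta W_n)$; - level-$l$ coarse: $\mathbf S^{c,l}_{n+1}=\mathbf S^{c,l}_n+\mathbf D^c(\mathbf S^{*,l}_n,\mathbf S^{c,l}_n,t_n,\Delta t,\delta W_n,\delta W_{n+1/2})$. The level-$l$ samples and the level-$(l-1)$ fine samples may be generated from different Brownian motions with the same law. *)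

theory Defs
  imports "HOL-Probability.Probability"
begin

definition partial_deriv :: "'d \<Rightarrow> (real^'d \<Rightarrow> real) \<Rightarrow> real^'d::finite \<Rightarrow> real" where
  "partial_deriv r f x = deriv (\<lambda>u. f (x + u *\<^sub>R axis r 1)) 0"

text \<open>Time ranges over \<open>[0, \<infinity>)\<close>, so the time derivative at \<open>0\<close> is one-sided. Only existence
  and boundedness of the partial derivatives are required, not total differentiability.\<close>

definition bounded_first_derivs :: "(real^'d::finite \<Rightarrow> real \<Rightarrow> real) \<Rightarrow> bool" where
  "bounded_first_derivs f \<longleftrightarrow>
     (\<exists>K. \<forall>x. \<forall>t\<ge>0.
        (\<forall>r. (\<lambda>u. f (x + u *\<^sub>R axis r 1) t) differentiable (at 0) \<and>
             \<bar>partial_deriv r (\<lambda>y. f y t) x\<bar> \<le> K) \<and>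
        (\<exists>D. ((\<lambda>s. f x s) has_real_derivative D) (at t within {0..}) \<and> \<bar>D\<bar> \<le> K))"

definition h_coeff ::
    "('d \<Rightarrow> 'm \<Rightarrow> real^'d \<Rightarrow> real \<Rightarrow> real) \<Rightarrow> 'd::finite \<Rightarrow> 'm \<Rightarrow> 'm \<Rightarrow> real^'d \<Rightarrow> real \<Rightarrow> real" where
  "h_coeff b i j k x t =
     1/2 * (\<Sum>r\<in>UNIV. b r k x t * partial_deriv r (\<lambda>y. b i j y t) x)"

definition correlation_matrix :: "real^'m^'m::finite \<Rightarrow> bool" where
  "correlation_matrix \<Omega> \<longleftrightarrow>
     transpose \<Omega> = \<Omega> \<and> (\<forall>j. \<Omega> $ j $ j = 1) \<and> (\<forall>u. 0 \<le> u \<bullet> (\<Omega> *v u))"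

text \<open>A random vector is centered Gaussian with (symmetric, positive semidefinite) covariance
  matrix \<open>C\<close> if each linear combination \<open>u \<bullet> X\<close> is normal with mean \<open>0\<close> and variance
  \<open>u \<bullet> C u\<close>; a degenerate normal variable is almost surely \<open>0\<close>.\<close>

definition centered_gaussian ::
    "'a measure \<Rightarrow> ('a \<Rightarrow> real^'m::finite) \<Rightarrow> real^'m^'m \<Rightarrow> bool" where
  "centered_gaussian M X C \<longleftrightarrow>
     X \<in> borel_measurable M \<and>
     (\<forall>u. if u \<bullet> (C *v u) = 0 then AE \<omega> in M. u \<bullet> X \<omega> = 0
          else distributed M lborel (\<lambda>\<omega>. u \<bullet> X \<omega>)
                 (normal_density 0 (sqrt (u \<bullet> (C *v u)))))"

definition brownian_motion ::
    "'a measure \<Rightarrow> (real \<Rightarrow> 'a \<Rightarrow> real^'m::finite) \<Rightarrow> real^'m^'m \<Rightarrow> bool" where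
  "brownian_motion M W \<Omega> \<longleftrightarrow>
     prob_space M \<and>
     (\<forall>t\<ge>0. W t \<in> borel_measurable M) \<and>
     (AE \<omega> in M. W 0 \<omega> = 0) \<and>
     (\<forall>(n::nat) \<tau>. 0 \<le> \<tau> 0 \<and> (\<forall>i<n. \<tau> i \<le> \<tau> (Suc i)) \<longrightarrow>
        prob_space.indep_vars M (\<lambda>_. borel) (\<lambda>i \<omega>. W (\<tau> (Suc i)) \<omega> - W (\<tau> i) \<omega>) {..<n}) \<and>
     (\<forall>t\<ge>0. \<forall>s\<ge>0. centered_gaussian M (\<lambda>\<omega>. W (t + s) \<omega> - W t \<omega>) (s *\<^sub>R \<Omega>)) \<and>
     (AE \<omega> in M. continuous_on {0..} (\<lambda>t. W t \<omega>))"

definition fine_incr ::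
    "('d \<Rightarrow> real^'d \<Rightarrow> real \<Rightarrow> real) \<Rightarrow> ('d \<Rightarrow> 'm \<Rightarrow> real^'d \<Rightarrow> real \<Rightarrow> real) \<Rightarrow> real^'m^'m \<Rightarrow>
     real^'d::finite \<Rightarrow> real \<Rightarrow> real \<Rightarrow> real^'m::finite \<Rightarrow> real^'d" where
  "fine_incr a b \<Omega> x t s w =
     (\<chi> i. a i x t * s + (\<Sum>j\<in>UNIV. b i j x t * w $ j)
          + (\<Sum>j\<in>UNIV. \<Sum>k\<in>UNIV. h_coeff b i j k x t * (w $ j * w $ k - \<Omega> $ j $ k * s)))"

definition coarse_incr ::
    "('d \<Rightarrow> real^'d \<Rightarrow> real \<Rightarrow> real) \<Rightarrow> ('d \<Rightarrow> 'm \<Rightarrow> real^'d \<Rightarrow> real \<Rightarrow> real) \<Rightarrow> real^'m^'m \<Rightarrow>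
     real^'d::finite \<Rightarrow> real^'d \<Rightarrow> real \<Rightarrow> real \<Rightarrow> real^'m::finite \<Rightarrow> real^'m \<Rightarrow> real^'d" where
  "coarse_incr a b \<Omega> x\<^sub>1 x\<^sub>2 t s w w' =
     (let v = w + w' in
      \<chi> i. a i x\<^sub>1 t * s + (\<Sum>j\<in>UNIV. b i j x\<^sub>2 t * v $ j)
          + (\<Sum>j\<in>UNIV. \<Sum>k\<in>UNIV. h_coeff b i j k x\<^sub>2 t *
               (v $ j * v $ k - \<Omega> $ j $ k * s - w $ j * w' $ k + w' $ j * w $ k)))"

definition step_size :: "real \<Rightarrow> nat \<Rightarrow> real" where
  "step_size T l = T / 2 ^ l"

text \<open>For a level \<open>l \<ge> 1\<close>: \<open>grid_time T l q\<close> is \<open>t\<^sub>q = q \<Delta>t\<close> with \<open>\<Delta>t = step_size T (l - 1)\<close>,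
  also for half-integers \<open>q\<close>.\<close>

definition grid_time :: "real \<Rightarrow> nat \<Rightarrow> real \<Rightarrow> real" where
  "grid_time T l q = q * step_size T (l - 1)"

definition half_incr :: "(real \<Rightarrow> 'a \<Rightarrow> real^'m) \<Rightarrow> real \<Rightarrow> nat \<Rightarrow> real \<Rightarrow> 'a \<Rightarrow> real^'m::finite" where
  "half_incr W T l q \<omega> = W (grid_time T l (q + 1/2)) \<omega> - W (grid_time T l q) \<omega>"

definition full_incr :: "(real \<Rightarrow> 'a \<Rightarrow> real^'m) \<Rightarrow> real \<Rightarrow> nat \<Rightarrow> nat \<Rightarrow> 'a \<Rightarrow> real^'m::finite" where
  "full_incr W T l n \<omega> = half_incr W T l (real n) \<omega> + half_incr W T l (real n + 1/2) \<omega>"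

text \<open>The level-\<open>(l - 1)\<close> fine scheme and the level-\<open>l\<close> starred scheme obey the same recursion with
  step \<open>\<Delta>t\<close>; they differ only in the Brownian motion \<open>W\<close> that drives them.\<close>

primrec S_fine ::
    "('d \<Rightarrow> real^'d \<Rightarrow> real \<Rightarrow> real) \<Rightarrow> ('d \<Rightarrow> 'm \<Rightarrow> real^'d \<Rightarrow> real \<Rightarrow> real) \<Rightarrow> real^'m^'m \<Rightarrow>
     real^'d::finite \<Rightarrow> real \<Rightarrow> nat \<Rightarrow> (real \<Rightarrow> 'a \<Rightarrow> real^'m::finite) \<Rightarrow> nat \<Rightarrow> 'a \<Rightarrow> real^'d" where
  "S_fine a b \<Omega> S\<^sub>0 T l W 0 \<omega> = S\<^sub>0"
| "S_fine a b \<Omega> S\<^sub>0 T l W (Suc n) \<omega> =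
     S_fine a b \<Omega> S\<^sub>0 T l W n \<omega>
     + fine_incr a b \<Omega> (S_fine a b \<Omega> S\<^sub>0 T l W n \<omega>)
         (grid_time T l (real n)) (step_size T (l - 1)) (full_incr W T l n \<omega>)"

abbreviation (input) "S_star \<equiv> S_fine"

primrec S_coarse ::
    "('d \<Rightarrow> real^'d \<Rightarrow> real \<Rightarrow> real) \<Rightarrow> ('d \<Rightarrow> 'm \<Rightarrow> real^'d \<Rightarrow> real \<Rightarrow> real) \<Rightarrow> real^'m^'m \<Rightarrow>
     real^'d::finite \<Rightarrow> real \<Rightarrow> nat \<Rightarrow> (real \<Rightarrow> 'a \<Rightarrow> real^'m::finite) \<Rightarrow> nat \<Rightarrow> 'a \<Rightarrow> real^'d" where
  "S_coarse a b \<Omega> S\<^sub>0 T l W 0 \<omega> = S\<^sub>0"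
| "S_coarse a b \<Omega> S\<^sub>0 T l W (Suc n) \<omega> =
     S_coarse a b \<Omega> S\<^sub>0 T l W n \<omega>
     + coarse_incr a b \<Omega> (S_star a b \<Omega> S\<^sub>0 T l W n \<omega>) (S_coarse a b \<Omega> S\<^sub>0 T l W n \<omega>)
         (grid_time T l (real n)) (step_size T (l - 1))
         (half_incr W T l (real n) \<omega>) (half_incr W T l (real n + 1/2) \<omega>)"

end

theory Submission imports Defs begin

text \<open>
  The fine scheme \<open>S\<close> and the coarse scheme \<open>C\<close> built from the same Brownian motion have increments
  with the same conditional mean. The increment of \<open>S\<close> is the drift \<open>a(S\<^sub>n) \<Delta>t\<close> plus products of
  coefficients at \<open>S\<^sub>n\<close> with \<open>v\<^sub>j\<close> and \<open>v\<^sub>j v\<^sub>k - \<Omega>\<^sub>j\<^sub>k \<Delta>t\<close>, where \<open>v\<close> is the Brownian increment of the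
  step. The increment of \<open>C\<close> has the drift of the fine scheme, \<open>a(S\<^sub>n) \<Delta>t\<close>, and its coefficients at
  \<open>C\<^sub>n\<close> are multiplied by the same factors, corrected by the antithetic terms \<open>- w\<^sub>j w'\<^sub>k + w'\<^sub>j w\<^sub>k\<close> of
  the half increments. All these factors have mean zero and are independent of \<open>(S\<^sub>n, C\<^sub>n)\<close>. Hence
  both means grow by \<open>E[a(S\<^sub>n)] \<Delta>t\<close> in each step (\<open>fine_step_mean\<close>, \<open>coarse_step_mean\<close>) and agree
  by induction. Integrability is carried along: the coefficients are Lipschitz in the state, hence
  of linear growth, and a product of independent integrable variables is integrable.

  It remains to replace the Brownian motion of one level by that of the other. As \<open>a\<close> is not linear,
  the mean of \<open>a(S\<^sub>n)\<close> depends on the whole law of \<open>S\<^sub>n\<close>, so this law has to be the same for both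
  Brownian motions (\<open>fine_law_unique\<close>). The law of \<open>S\<^sub>n\<close> is built from the laws of the independent
  increments, and these are Gaussian vectors described through their one-dimensional projections
  only. That such projections determine the law is the Cramer-Wold theorem (\<open>cramer_wold\<close>). It is
  derived here from the one-dimensional uniqueness theorem for characteristic functions, one
  coordinate after the other.
\<close>

section \<open>Componentwise measurability and integration of vectors\<close>

lemma borel_measurable_vec_nth:
  "(\<lambda>x :: real^'n::finite. x $ i) \<in> borel_measurable borel"
  by (intro borel_measurable_continuous_onI continuous_intros)

lemma vec_sum_axis:
  fixes x :: "real^'n::finite"
  shows "(\<Sum>i\<in>UNIV. x $ i *\<^sub>R (axis i 1 :: real^'n)) = x"
  using basis_expansion[of x] by (simp add: scalar_mult_eq_scaleR)

lemma borel_measurable_vecI: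
  fixes f :: "'a \<Rightarrow> real^'n::finite"
  assumes "\<And>i. (\<lambda>\<omega>. f \<omega> $ i) \<in> borel_measurable M"
  shows "f \<in> borel_measurable M"
proof -
  have "(\<lambda>\<omega>. \<Sum>i\<in>UNIV. f \<omega> $ i *\<^sub>R (axis i 1 :: real^'n)) \<in> borel_measurable M"
    using assms by auto
  then show ?thesis by (simp only: vec_sum_axis)
qed

lemma integrable_vecI:
  fixes f :: "'a \<Rightarrow> real^'n::finite"
  assumes "\<And>i. integrable M (\<lambda>\<omega>. f \<omega> $ i)"
  shows "integrable M f"
proof -
  have "integrable M (\<lambda>\<omega>. \<Sum>i\<in>UNIV. f \<omega> $ i *\<^sub>R (axis i 1 :: real^'n))"
    using assms by auto
  then show ?thesis by (simp only: vec_sum_axis)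
qed

lemma integrable_vec_nth:
  fixes f :: "'a \<Rightarrow> real^'n::finite"
  assumes "integrable M f"
  shows "integrable M (\<lambda>\<omega>. f \<omega> $ i)"
  by (rule integrable_bounded_linear[OF bounded_linear_vec_nth assms])

lemma integral_vec_nth:
  fixes f :: "'a \<Rightarrow> real^'n::finite"
  assumes "integrable M f"
  shows "(\<integral>\<omega>. f \<omega> \<partial>M) $ i = (\<integral>\<omega>. f \<omega> $ i \<partial>M)"
  by (rule integral_bounded_linear[OF bounded_linear_vec_nth assms, symmetric])

section \<open>Regularity of the coefficients\<close>

text \<open>Only partial derivatives are available, so the mean value theorem is used along one coordinate
  axis at a time: \<open>y\<close> is turned into \<open>x\<close> by replacing its coordinates successively, and each
  replacement costs at most \<open>K\<close> times the change of that coordinate. This yields the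
  measurability and the linear growth of the coefficients, so that integrability of a state
  passes to the coefficients evaluated there.\<close>

lemma bounded_first_derivs_lipschitz:
  fixes f :: "real^'d::finite \<Rightarrow> real \<Rightarrow> real"
  assumes "bounded_first_derivs f"
  obtains K where "\<And>x y t. 0 \<le> t \<Longrightarrow> \<bar>f x t - f y t\<bar> \<le> K * (\<Sum>r\<in>UNIV. \<bar>x $ r - y $ r\<bar>)"
proof -
  obtain K where K:
    "\<And>x t r. 0 \<le> t \<Longrightarrow> (\<lambda>u. f (x + u *\<^sub>R axis r 1) t) differentiable (at 0)"
    "\<And>x t r. 0 \<le> t \<Longrightarrow> \<bar>partial_deriv r (\<lambda>y. f y t) x\<bar> \<le> K"
    using assms unfolding bounded_first_derivs_def by blast
  have one: "\<bar>f (x + h *\<^sub>R axis r 1) t - f x t\<bar> \<le> K * \<bar>h\<bar>" if t: "0 \<le> t" for x t r h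
  proof -
    \<comment> \<open>The derivative at \<open>v\<close> is the partial derivative at a shifted base point.\<close>
    have deriv: "((\<lambda>u. f (x + u *\<^sub>R axis r 1) t) has_real_derivative
        partial_deriv r (\<lambda>y. f y t) (x + v *\<^sub>R axis r 1)) (at v)" for v
    proof -
      have "((\<lambda>u. f (x + v *\<^sub>R axis r 1 + u *\<^sub>R axis r 1) t) has_real_derivative
          partial_deriv r (\<lambda>y. f y t) (x + v *\<^sub>R axis r 1)) (at 0)"
        unfolding partial_deriv_def using K(1)[OF t]
        by (simp add: DERIV_deriv_iff_real_differentiable)
      then have "((\<lambda>u. f (x + v *\<^sub>R axis r 1 + (u - v) *\<^sub>R axis r 1) t) has_real_derivative
          partial_deriv r (\<lambda>y. f y t) (x + v *\<^sub>R axis r 1)) (at v)"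
        using DERIV_shift[of "\<lambda>u. f (x + v *\<^sub>R axis r 1 + (u - v) *\<^sub>R axis r 1) t" _ 0 v]
        by (simp add: add.commute)
      moreover have "x + v *\<^sub>R axis r 1 + (u - v) *\<^sub>R axis r 1 = x + u *\<^sub>R axis r 1" for u
        by (simp add: scaleR_diff_left)
      ultimately show ?thesis by simp
    qed
    have "norm (f (x + h *\<^sub>R axis r 1) t - f (x + 0 *\<^sub>R axis r 1) t) \<le> K * norm (h - 0)"
      by (rule field_differentiable_bound[where S = UNIV and f' = "\<lambda>v. partial_deriv r (\<lambda>y. f y t) (x + v *\<^sub>R axis r 1)"])
        (use deriv K(2)[OF t] in \<open>auto intro: DERIV_subset\<close>)
    then show ?thesis by simp
  qed
  have part: "\<bar>f (\<chi> r. if r \<in> J then x $ r else y $ r) t - f y t\<bar> \<le> K * (\<Sum>r\<in>J. \<bar>x $ r - y $ r\<bar>)"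
    if "finite J" "0 \<le> t" for J x y t
    using that
  proof (induction J)
    case empty
    then show ?case by simp
  next
    case (insert s J)
    let ?z = "\<lambda>J. \<chi> r. if r \<in> J then x $ r else y $ r"
    have "?z (insert s J) = ?z J + (x $ s - y $ s) *\<^sub>R axis s 1"
      using insert.hyps by (auto simp: vec_eq_iff axis_def)
    then have "\<bar>f (?z (insert s J)) t - f (?z J) t\<bar> \<le> K * \<bar>x $ s - y $ s\<bar>"
      using one[OF insert.prems] by metis
    moreover have "\<bar>f (?z J) t - f y t\<bar> \<le> K * (\<Sum>r\<in>J. \<bar>x $ r - y $ r\<bar>)"
      by (rule insert.IH) fact
    ultimately show ?case
      using insert.hyps by (simp add: algebra_simps)
  qed
  show ?thesis
  proof (rule that)
    fix x y :: "real^'d" and t :: real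
    assume "0 \<le> t"
    then show "\<bar>f x t - f y t\<bar> \<le> K * (\<Sum>r\<in>UNIV. \<bar>x $ r - y $ r\<bar>)"
      using part[of UNIV t x y] by simp
  qed
qed

lemma bounded_first_derivs_measurable:
  fixes f :: "real^'d::finite \<Rightarrow> real \<Rightarrow> real"
  assumes "bounded_first_derivs f" "0 \<le> t"
  shows "(\<lambda>x. f x t) \<in> borel_measurable borel"
proof (rule borel_measurable_continuous_onI)
  obtain K where K: "\<And>x y. \<bar>f x t - f y t\<bar> \<le> K * (\<Sum>r\<in>UNIV. \<bar>x $ r - y $ r\<bar>)"
    using bounded_first_derivs_lipschitz[OF assms(1)] assms(2) by metis
  show "continuous_on UNIV (\<lambda>x. f x t)"
    unfolding continuous_on_def
  proof
    fix y :: "real^'d"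
    have "((\<lambda>x. K * (\<Sum>r\<in>UNIV. \<bar>x $ r - y $ r\<bar>)) \<longlongrightarrow> K * (\<Sum>r\<in>UNIV. \<bar>y $ r - y $ r\<bar>)) (at y)"
      by (intro tendsto_intros)
    then have "((\<lambda>x. K * (\<Sum>r\<in>UNIV. \<bar>x $ r - y $ r\<bar>)) \<longlongrightarrow> 0) (at y)"
      by simp
    then have "((\<lambda>x. f x t - f y t) \<longlongrightarrow> 0) (at y)"
      by (rule Lim_null_comparison[rotated]) (use K in \<open>auto intro!: always_eventually\<close>)
    then show "((\<lambda>x. f x t) \<longlongrightarrow> f y t) (at y)"
      by (rule LIM_zero_cancel)
  qed
qed

lemma (in prob_space) bounded_first_derivs_integrable:
  fixes f :: "real^'d::finite \<Rightarrow> real \<Rightarrow> real"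
  assumes f: "bounded_first_derivs f" "0 \<le> t"
    and X: "X \<in> borel_measurable M" "\<And>r. integrable M (\<lambda>\<omega>. X \<omega> $ r)"
  shows "integrable M (\<lambda>\<omega>. f (X \<omega>) t)"
proof -
  obtain K where K: "\<And>x y. \<bar>f x t - f y t\<bar> \<le> K * (\<Sum>r\<in>UNIV. \<bar>x $ r - y $ r\<bar>)"
    using bounded_first_derivs_lipschitz[OF f(1)] f(2) by metis
  show ?thesis
  proof (rule Bochner_Integration.integrable_bound)
    show "integrable M (\<lambda>\<omega>. \<bar>f 0 t\<bar> + K * (\<Sum>r\<in>UNIV. \<bar>X \<omega> $ r\<bar>))"
      using X(2) by auto
    show "(\<lambda>\<omega>. f (X \<omega>) t) \<in> borel_measurable M"
      using measurable_compose[OF X(1) bounded_first_derivs_measurable[OF f]] .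
    have "\<bar>f (X \<omega>) t\<bar> \<le> \<bar>f 0 t\<bar> + K * (\<Sum>r\<in>UNIV. \<bar>X \<omega> $ r\<bar>)" for \<omega>
      using K[of "X \<omega>" 0] by simp
    then show "AE \<omega> in M. norm (f (X \<omega>) t) \<le> norm (\<bar>f 0 t\<bar> + K * (\<Sum>r\<in>UNIV. \<bar>X \<omega> $ r\<bar>))"
      by (auto intro!: AE_I2 order_trans[OF _ abs_ge_self])
  qed
qed

section \<open>Laws of random vectors are determined by their one-dimensional projections\<close>

text \<open>One-dimensional uniqueness of characteristic functions under a bounded weight \<open>g\<close>. The law of
  \<open>X\<close> under the probability density \<open>g / \<integral>g\<close> has a characteristic function that is proportional
  to the assumed integral. The total masses \<open>\<integral>g\<close> agree by the choice \<open>s = 0\<close>; if they vanish, both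
  sides are \<open>0\<close>.\<close>

lemma integral_eq_of_weighted_char_eq:
  fixes P Q :: "'a measure" and g X :: "'a \<Rightarrow> real" and h :: "real \<Rightarrow> real"
  assumes P: "prob_space P" and Q: "prob_space Q" and sets: "sets P = sets Q"
    and g[measurable]: "g \<in> borel_measurable P" and X[measurable]: "X \<in> borel_measurable P"
    and g_bd: "\<And>x. 0 \<le> g x" "\<And>x. g x \<le> B"
    and eq: "\<And>s. (CLINT x|P. g x * iexp (s * X x)) = (CLINT x|Q. g x * iexp (s * X x))"
    and h[measurable]: "h \<in> borel_measurable borel"
  shows "(\<integral>x. g x * h (X x) \<partial>P) = (\<integral>x. g x * h (X x) \<partial>Q)"
proof -
  interpret P: prob_space P by fact
  interpret Q: prob_space Q by fact
  note [measurable_cong] = sets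
  have [measurable]: "g \<in> borel_measurable Q" "X \<in> borel_measurable Q"
    using g X measurable_cong_sets[OF sets refl] by blast+
  have iP: "integrable P g" and iQ: "integrable Q g"
    by (auto intro!: P.integrable_const_bound[where B = B] Q.integrable_const_bound[where B = B] simp: g_bd)
  define m where "m = (\<integral>x. g x \<partial>P)"
  have mQ: "m = (\<integral>x. g x \<partial>Q)"
    using eq[of 0] by (simp add: m_def)
  have m0: "0 \<le> m" unfolding m_def by (simp add: g_bd)
  show ?thesis
  proof (cases "m = 0")
    case True
    then have z: "AE x in P. g x = 0" "AE x in Q. g x = 0"
      using integral_nonneg_eq_0_iff_AE[OF iP] integral_nonneg_eq_0_iff_AE[OF iQ] g_bd m_def mQ
      by auto
    have "(\<integral>x. g x * h (X x) \<partial>P) = 0" "(\<integral>x. g x * h (X x) \<partial>Q) = 0"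
      by (rule integral_eq_zero_AE, use z in force)+
    then show ?thesis by simp
  next
    case False
    with m0 have m: "0 < m" by simp
    define law where "law R = distr (density R (\<lambda>x. ennreal (g x / m))) borel X" for R :: "'a measure"
    have law_real: "real_distribution (law R)"
      if R: "prob_space R" "sets R = sets P" "m = (\<integral>x. g x \<partial>R)" "integrable R g" for R
    proof -
      note [measurable_cong] = R(2)
      interpret R: prob_space R by (rule R)
      have "(\<integral>\<^sup>+x. ennreal (g x / m) \<partial>R) = ennreal (\<integral>x. g x / m \<partial>R)"
        by (rule nn_integral_eq_integral) (use R(4) m g_bd in auto)
      also have "(\<integral>x. g x / m \<partial>R) = 1"
        using m by (simp add: R(3)[symmetric])
      finally have "emeasure (density R (\<lambda>x. ennreal (g x / m))) (space R) = 1"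
        by (simp add: emeasure_density cong: nn_integral_cong)
      then have "prob_space (density R (\<lambda>x. ennreal (g x / m)))"
        by (intro prob_spaceI) simp
      then have "prob_space (law R)"
        unfolding law_def by (rule prob_space.prob_space_distr) simp
      then show ?thesis
        unfolding real_distribution_def real_distribution_axioms_def by (simp add: law_def)
    qed
    have law_integral: "(\<integral>x. k x \<partial>law R) = (\<integral>x. g x *\<^sub>R k (X x) \<partial>R) /\<^sub>R m"
      if R[measurable_cong]: "sets R = sets P" and k[measurable]: "k \<in> borel_measurable borel"
      for R and k :: "real \<Rightarrow> 'c::{banach,second_countable_topology}"
    proof -
      have "(\<integral>x. k x \<partial>law R) = (\<integral>x. k (X x) \<partial>density R (\<lambda>x. ennreal (g x / m)))"
        unfolding law_def by (rule integral_distr) measurable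
      also have "\<dots> = (\<integral>x. (g x / m) *\<^sub>R k (X x) \<partial>R)"
        by (rule integral_density) (use m g_bd in auto)
      also have "\<dots> = (\<integral>x. inverse m *\<^sub>R (g x *\<^sub>R k (X x)) \<partial>R)"
        by (simp add: divide_inverse mult.commute)
      also have "\<dots> = (\<integral>x. g x *\<^sub>R k (X x) \<partial>R) /\<^sub>R m"
        by (rule integral_scaleR_right)
      finally show ?thesis .
    qed
    have "law P = law Q"
    proof (rule Levy_uniqueness)
      show "real_distribution (law P)"
        by (rule law_real) (use P m_def iP in auto)
      show "real_distribution (law Q)"
        by (rule law_real) (use Q sets mQ iQ in auto)
      show "char (law P) = char (law Q)"
      proof
        fix s
        have "(CLINT x|P. g x *\<^sub>R iexp (s * X x)) = (CLINT x|Q. g x *\<^sub>R iexp (s * X x))"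
          unfolding scaleR_conv_of_real by (rule eq)
        then show "char (law P) s = char (law Q) s"
          unfolding char_def using law_integral[of P "\<lambda>x. iexp (s * x)"] law_integral[of Q "\<lambda>x. iexp (s * x)"] sets
          by simp
      qed
    qed
    moreover have "(\<integral>x. h x \<partial>law P) = (\<integral>x. g x * h (X x) \<partial>P) /\<^sub>R m"
      using law_integral[OF refl h] by simp
    moreover have "(\<integral>x. h x \<partial>law Q) = (\<integral>x. g x * h (X x) \<partial>Q) /\<^sub>R m"
      using law_integral[OF sets[symmetric] h] by simp
    ultimately show ?thesis using m by simp
  qed
qed

text \<open>The induction step of the multivariate uniqueness theorem. The one-dimensional result, applied
  to the coordinate \<open>x $ k\<close>, needs nonnegative weights, whereas \<open>iexp (u \<bullet> x)\<close> is complex; hence it is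
  applied to the weights \<open>p\<close>, \<open>p (1 + cos (u \<bullet> x))\<close> and \<open>p (1 + sin (u \<bullet> x))\<close>. Multiplying these by
  \<open>iexp (s * x $ k)\<close> gives linear combinations of \<open>p\<close> times exponentials with frequencies \<open>s e\<^sub>k\<close>,
  \<open>u + s e\<^sub>k\<close> and \<open>-u + s e\<^sub>k\<close>, to which the hypothesis applies.\<close>

lemma weighted_char_eq_restrict_halfspace:
  fixes P Q :: "(real^'m::finite) measure" and p :: "real^'m \<Rightarrow> real"
  assumes P: "prob_space P" "sets P = sets borel" and Q: "prob_space Q" "sets Q = sets borel"
    and p[measurable]: "p \<in> borel_measurable borel" and p01: "\<And>x. 0 \<le> p x" "\<And>x. p x \<le> 1"
    and eq: "\<And>u. (CLINT x|P. p x * iexp (u \<bullet> x)) = (CLINT x|Q. p x * iexp (u \<bullet> x))"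
  shows "(CLINT x|P. (p x * indicator {..c} (x $ k) :: real) * iexp (u \<bullet> x)) =
         (CLINT x|Q. (p x * indicator {..c} (x $ k) :: real) * iexp (u \<bullet> x))"
proof -
  interpret P: prob_space P by fact
  interpret Q: prob_space Q by fact
  note [measurable_cong] = P(2) Q(2)
  let ?q = "\<lambda>x. indicator {..c} (x $ k) :: real"
  note [measurable] = borel_measurable_vec_nth
  have q01: "0 \<le> ?q x" "?q x \<le> 1" for x :: "real^'m"
    by (auto simp: indicator_def)
  have intP: "integrable P f" and intQ: "integrable Q f"
    if [measurable]: "f \<in> borel_measurable borel" and "\<And>x. norm (f x) \<le> 2"
    for f :: "real^'m \<Rightarrow> 'c::{banach,second_countable_topology}"
    using that(2)
    by (auto intro!: P.integrable_const_bound[where B = 2] Q.integrable_const_bound[where B = 2])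
  have weight: "(\<integral>x. p x * w x * ?q x \<partial>P) = (\<integral>x. p x * w x * ?q x \<partial>Q)"
    if w[measurable]: "w \<in> borel_measurable borel" and w02: "\<And>x. 0 \<le> w x" "\<And>x. w x \<le> 2"
      and trig: "\<And>x. complex_of_real (w x) = c0 + c1 * iexp (u \<bullet> x) + c2 * iexp (- u \<bullet> x)"
    for w c0 c1 c2
  proof (rule integral_eq_of_weighted_char_eq[where B = 2 and g = "\<lambda>x. p x * w x"
        and X = "\<lambda>x. x $ k" and h = "indicator {..c}", OF P(1) Q(1)])
    show "sets P = sets Q" using P(2) Q(2) by simp
    show "0 \<le> p x * w x" for x using p01 w02 by simp
    show "p x * w x \<le> 2" for x using mult_mono[of "p x" 1 "w x" 2] p01[of x] w02[of x] by simp
    fix s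
    let ?e = "\<lambda>v x. p x * iexp ((v + s *\<^sub>R axis k 1) \<bullet> x)"
    have norm_e: "norm (?e v x) \<le> 2" for v x
      using p01[of x] by (simp add: norm_mult abs_mult)
    have iP: "integrable P (?e v)" and iQ: "integrable Q (?e v)" for v
      by (rule intP intQ, measurable, rule norm_e)+
    have *: "complex_of_real (p x * w x) * iexp (s * x $ k) = c0 * ?e 0 x + c1 * ?e u x + c2 * ?e (- u) x" for x
    proof -
      have factor: "iexp ((v + s *\<^sub>R axis k 1) \<bullet> x) = iexp (v \<bullet> x) * iexp (s * x $ k)" for v
        by (simp add: inner_add_left inner_axis' algebra_simps flip: exp_add)
      show ?thesis
        unfolding of_real_mult trig factor by (simp add: algebra_simps)
    qed
    show "(CLINT x|P. complex_of_real (p x * w x) * iexp (s * x $ k)) =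
        (CLINT x|Q. complex_of_real (p x * w x) * iexp (s * x $ k))"
      unfolding * by (simp only: iP iQ eq Bochner_Integration.integral_add Bochner_Integration.integrable_add
          integrable_mult_right integral_mult_right_zero)
  qed measurable
  have one: "(\<integral>x. p x * 1 * ?q x \<partial>P) = (\<integral>x. p x * 1 * ?q x \<partial>Q)"
    by (rule weight[of _ 1 0 0]) auto
  have trig_bd: "0 \<le> 1 + cos r" "0 \<le> 1 + sin r" "1 + cos r \<le> 2" "1 + sin r \<le> 2" for r :: real
    using cos_ge_minus_one[of r] sin_ge_minus_one[of r] cos_le_one[of r] sin_le_one[of r] by linarith+
  have c: "(\<integral>x. p x * (1 + cos (u \<bullet> x)) * ?q x \<partial>P) = (\<integral>x. p x * (1 + cos (u \<bullet> x)) * ?q x \<partial>Q)"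
  proof (rule weight[of _ 1 "1/2" "1/2"])
    show "complex_of_real (1 + cos (u \<bullet> x)) = 1 + 1/2 * iexp (u \<bullet> x) + 1/2 * iexp (- u \<bullet> x)" for x
      by (simp add: complex_eq_iff exp_eq_polar)
  qed (auto simp: trig_bd)
  have s: "(\<integral>x. p x * (1 + sin (u \<bullet> x)) * ?q x \<partial>P) = (\<integral>x. p x * (1 + sin (u \<bullet> x)) * ?q x \<partial>Q)"
  proof (rule weight[of _ 1 "-\<i>/2" "\<i>/2"])
    show "complex_of_real (1 + sin (u \<bullet> x)) = 1 + -\<i>/2 * iexp (u \<bullet> x) + \<i>/2 * iexp (- u \<bullet> x)" for x
      by (simp add: complex_eq_iff exp_eq_polar)
  qed (auto simp: trig_bd)
  have pqr: "norm (p x * ?q x * z) \<le> 2" if "\<bar>z\<bar> \<le> 1" for x z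
  proof -
    have "\<bar>p x * ?q x\<bar> * \<bar>z\<bar> \<le> (1 * 1) * 1"
      unfolding abs_mult using that p01[of x] q01[of x] by (intro mult_mono) auto
    then show ?thesis by (simp add: abs_mult)
  qed
  have iP: "integrable P (\<lambda>x. p x * ?q x * r x)" and iQ: "integrable Q (\<lambda>x. p x * ?q x * r x)"
    if [measurable]: "r \<in> borel_measurable borel" and r: "\<And>x. \<bar>r x\<bar> \<le> 1" for r
    by (rule intP intQ, measurable, rule pqr, rule r)+
  \<comment> \<open>Subtracting the result for the weight \<open>p\<close> leaves the integrals with \<open>cos\<close> and \<open>sin\<close> themselves.\<close>
  have split: "(\<integral>x. p x * ?q x * r x \<partial>P) = (\<integral>x. p x * ?q x * r x \<partial>Q)"
    if r: "r \<in> borel_measurable borel" "\<And>x. \<bar>r x\<bar> \<le> 1"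
      and eq: "(\<integral>x. p x * (1 + r x) * ?q x \<partial>P) = (\<integral>x. p x * (1 + r x) * ?q x \<partial>Q)" for r
  proof -
    have *: "p x * ?q x * r x = p x * (1 + r x) * ?q x - p x * 1 * ?q x"
        "p x * (1 + r x) * ?q x = p x * ?q x * r x + p x * ?q x * 1"
        "p x * 1 * ?q x = p x * ?q x * 1" for x
      by (simp_all add: algebra_simps)
    have "integrable R (\<lambda>x. p x * (1 + r x) * ?q x)" "integrable R (\<lambda>x. p x * 1 * ?q x)" if "R = P \<or> R = Q" for R
      using that iP[OF r] iQ[OF r] iP[of "\<lambda>_. 1"] iQ[of "\<lambda>_. 1"] unfolding *(2,3) by auto
    then show ?thesis
      unfolding *(1) using eq one by simp
  qed
  have e: "complex_of_real (p x * ?q x) * iexp (u \<bullet> x) =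
      complex_of_real (p x * ?q x * cos (u \<bullet> x)) + \<i> * complex_of_real (p x * ?q x * sin (u \<bullet> x))" for x
    by (simp add: complex_eq_iff exp_eq_polar)
  have "integrable R (\<lambda>x. p x * ?q x * cos (u \<bullet> x))" "integrable R (\<lambda>x. p x * ?q x * sin (u \<bullet> x))"
    if "R = P \<or> R = Q" for R
    using that by (auto intro!: iP iQ)
  then have int: "(CLINT x|R. complex_of_real (p x * ?q x) * iexp (u \<bullet> x)) =
      complex_of_real (\<integral>x. p x * ?q x * cos (u \<bullet> x) \<partial>R) + \<i> * complex_of_real (\<integral>x. p x * ?q x * sin (u \<bullet> x) \<partial>R)"
    if "R = P \<or> R = Q" for R
    unfolding e using that by (simp del: of_real_mult)
  show ?thesis
    using split[OF _ _ c] split[OF _ _ s] int[of P] int[of Q] by simp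
qed

text \<open>Multivariate uniqueness of characteristic functions. Restricting to one half-space
  \<open>x $ j \<le> c j\<close> after another shows that both measures agree on all orthants, and the orthants
  form an intersection-stable generator of the Borel sets.\<close>

lemma vec_char_eq_imp_eq:
  fixes P Q :: "(real^'m::finite) measure"
  assumes P: "prob_space P" "sets P = sets borel" and Q: "prob_space Q" "sets Q = sets borel"
    and eq: "\<And>u. (CLINT x|P. iexp (u \<bullet> x)) = (CLINT x|Q. iexp (u \<bullet> x))"
  shows "P = Q"
proof -
  interpret P: prob_space P by fact
  interpret Q: prob_space Q by fact
  have spc: "space P = UNIV" "space Q = UNIV"
    using sets_eq_imp_space_eq[OF P(2)] sets_eq_imp_space_eq[OF Q(2)] by simp_all
  note [measurable] = borel_measurable_vec_nth
  have orthant: "(CLINT x|P. (\<Prod>j\<in>J. indicator {..c j} (x $ j) :: real) * iexp (u \<bullet> x)) =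
      (CLINT x|Q. (\<Prod>j\<in>J. indicator {..c j} (x $ j) :: real) * iexp (u \<bullet> x))"
    if "finite J" for J u and c :: "'m \<Rightarrow> real"
    using that
  proof (induction J arbitrary: u)
    case empty
    then show ?case using eq by simp
  next
    case (insert k J)
    have "(\<lambda>x :: real^'m. \<Prod>j\<in>J. indicator {..c j} (x $ j) :: real) \<in> borel_measurable borel"
      by measurable
    moreover have "0 \<le> (\<Prod>j\<in>J. indicator {..c j} (x $ j) :: real)" "(\<Prod>j\<in>J. indicator {..c j} (x $ j) :: real) \<le> 1"
      for x :: "real^'m"
      by (auto intro!: prod_nonneg prod_le_1 simp: indicator_def)
    ultimately show ?case
      using weighted_char_eq_restrict_halfspace[OF P Q _ _ _ insert.IH] insert.hyps
      by (simp add: mult.commute)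
  qed
  have box: "emeasure P {..c} = emeasure Q {..c}" for c :: "real^'m"
  proof -
    have *: "(\<Prod>j\<in>UNIV. indicator {..c $ j} (x $ j) :: real) = indicator {..c} x" for x
      by (auto simp: indicator_def less_eq_vec_def intro: prod_zero)
    have "complex_of_real (measure P {..c}) = complex_of_real (measure Q {..c})"
      using orthant[of UNIV "\<lambda>j. c $ j" 0] by (simp add: * spc)
    then show ?thesis
      by (simp add: P.emeasure_eq_measure Q.emeasure_eq_measure)
  qed
  show ?thesis
  proof (rule measure_eqI_generator_eq)
    show "Int_stable (range (\<lambda>c. {..c :: real^'m}))"
      unfolding Int_stable_def
    proof safe
      fix a b :: "real^'m"
      have "{..a} \<inter> {..b} = {..inf a b}" by auto
      then show "{..a} \<inter> {..b} \<in> range (\<lambda>c. {..c})" by blast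
    qed
    show "sets P = sigma_sets UNIV (range (\<lambda>c. {..c}))" "sets Q = sigma_sets UNIV (range (\<lambda>c. {..c}))"
      using P(2) Q(2) by (simp_all add: borel_eq_atMost)
    show "emeasure P A = emeasure Q A" if "A \<in> range (\<lambda>c. {..c})" for A
      using that box by auto
    show "(\<Union>i. {..\<chi> j. real i}) = (UNIV :: (real^'m) set)"
    proof -
      have "\<exists>i. x \<le> (\<chi> j. real i)" for x :: "real^'m"
      proof -
        obtain i where "norm x \<le> real i" using real_arch_simple by blast
        then have "x $ j \<le> real i" for j
          using component_le_norm_cart[of x j] by linarith
        then show ?thesis by (auto simp: less_eq_vec_def)
      qed
      then show ?thesis by auto
    qed
  qed auto
qed

text \<open>The characteristic function of a vector at \<open>u\<close> is an integral over the law of \<open>u \<bullet> X\<close> alone.\<close>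

theorem cramer_wold:
  fixes X :: "'a \<Rightarrow> real^'m::finite" and Y :: "'b \<Rightarrow> real^'m"
  assumes M: "prob_space M" and N: "prob_space N"
    and X[measurable]: "X \<in> borel_measurable M" and Y[measurable]: "Y \<in> borel_measurable N"
    and eq: "\<And>u. distr M borel (\<lambda>\<omega>. u \<bullet> X \<omega>) = distr N borel (\<lambda>\<omega>. u \<bullet> Y \<omega>)"
  shows "distr M borel X = distr N borel Y"
proof (rule vec_char_eq_imp_eq)
  show "prob_space (distr M borel X)" "prob_space (distr N borel Y)"
    by (auto intro!: prob_space.prob_space_distr M N)
  fix u :: "real^'m"
  have "(CLINT x|distr M borel X. iexp (u \<bullet> x)) = (CLINT r|distr M borel (\<lambda>\<omega>. u \<bullet> X \<omega>). iexp r)"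
    by (simp add: integral_distr)
  also have "\<dots> = (CLINT x|distr N borel Y. iexp (u \<bullet> x))"
    by (simp add: eq integral_distr)
  finally show "(CLINT x|distr M borel X. iexp (u \<bullet> x)) = (CLINT x|distr N borel Y. iexp (u \<bullet> x))" .
qed simp_all

section \<open>Gaussian vectors\<close>

lemma centered_gaussian_law_unique:
  assumes M: "prob_space M" and N: "prob_space N"
    and X: "centered_gaussian M X C" and Y: "centered_gaussian N Y C"
  shows "distr M borel X = distr N borel Y"
proof (rule cramer_wold[OF M N])
  interpret M: prob_space M by (rule M)
  interpret N: prob_space N by (rule N)
  show X_meas[measurable]: "X \<in> borel_measurable M" and Y_meas[measurable]: "Y \<in> borel_measurable N"
    using X Y unfolding centered_gaussian_def by blast+
  show "distr M borel (\<lambda>\<omega>. u \<bullet> X \<omega>) = distr N borel (\<lambda>\<omega>. u \<bullet> Y \<omega>)" for u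
  proof (cases "u \<bullet> (C *v u) = 0")
    case True
    then have z: "AE \<omega> in M. u \<bullet> X \<omega> = 0" "AE \<omega> in N. u \<bullet> Y \<omega> = 0"
      using X Y unfolding centered_gaussian_def by metis+
    have "distr M borel (\<lambda>\<omega>. u \<bullet> X \<omega>) = distr M borel (\<lambda>_. 0)"
      by (rule distr_cong_AE) (use z in auto)
    also have "\<dots> = distr N borel (\<lambda>_. 0)"
      by (simp add: M.distr_const N.distr_const)
    also have "\<dots> = distr N borel (\<lambda>\<omega>. u \<bullet> Y \<omega>)"
      by (rule distr_cong_AE) (use z in auto)
    finally show ?thesis .
  next
    case False
    then have "distributed M lborel (\<lambda>\<omega>. u \<bullet> X \<omega>) (normal_density 0 (sqrt (u \<bullet> (C *v u))))"
      "distributed N lborel (\<lambda>\<omega>. u \<bullet> Y \<omega>) (normal_density 0 (sqrt (u \<bullet> (C *v u))))"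
      using X Y unfolding centered_gaussian_def by metis+
    then have "distr M lborel (\<lambda>\<omega>. u \<bullet> X \<omega>) = distr N lborel (\<lambda>\<omega>. u \<bullet> Y \<omega>)"
      unfolding distributed_def by simp
    then show ?thesis
      by (simp cong: distr_cong)
  qed
qed

lemma (in prob_space) centered_gaussian_linear_moments:
  assumes X: "centered_gaussian M X C" and psd: "\<And>u. 0 \<le> u \<bullet> (C *v u)"
  shows "integrable M (\<lambda>\<omega>. u \<bullet> X \<omega>)" "expectation (\<lambda>\<omega>. u \<bullet> X \<omega>) = 0"
    "integrable M (\<lambda>\<omega>. (u \<bullet> X \<omega>)\<^sup>2)" "expectation (\<lambda>\<omega>. (u \<bullet> X \<omega>)\<^sup>2) = u \<bullet> (C *v u)"
proof -
  let ?v = "u \<bullet> (C *v u)"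
  have X_meas[measurable]: "X \<in> borel_measurable M"
    using X unfolding centered_gaussian_def by blast
  have "integrable M (\<lambda>\<omega>. u \<bullet> X \<omega>) \<and> expectation (\<lambda>\<omega>. u \<bullet> X \<omega>) = 0 \<and>
    integrable M (\<lambda>\<omega>. (u \<bullet> X \<omega>)\<^sup>2) \<and> expectation (\<lambda>\<omega>. (u \<bullet> X \<omega>)\<^sup>2) = ?v"
  proof (cases "?v = 0")
    case True
    then have z: "AE \<omega> in M. u \<bullet> X \<omega> = 0"
      using X unfolding centered_gaussian_def by metis
    have "integrable M (\<lambda>\<omega>. u \<bullet> X \<omega>) \<longleftrightarrow> integrable M (\<lambda>_. 0 :: real)"
      "integrable M (\<lambda>\<omega>. (u \<bullet> X \<omega>)\<^sup>2) \<longleftrightarrow> integrable M (\<lambda>_. 0 :: real)"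
      by (rule integrable_cong_AE; use z in auto)+
    moreover have "expectation (\<lambda>\<omega>. u \<bullet> X \<omega>) = 0" "expectation (\<lambda>\<omega>. (u \<bullet> X \<omega>)\<^sup>2) = 0"
      by (rule integral_eq_zero_AE; use z in auto)+
    ultimately show ?thesis using True by simp
  next
    case False
    with psd[of u] have s: "0 < sqrt ?v" by simp
    have D: "distributed M lborel (\<lambda>\<omega>. u \<bullet> X \<omega>) (normal_density 0 (sqrt ?v))"
      using X False unfolding centered_gaussian_def by metis
    have "integrable M (\<lambda>\<omega>. u \<bullet> X \<omega>)"
      using distributed_integrable[OF D, of "\<lambda>x. x"] integrable_normal_moment[OF s, of 0 1] by simp
    moreover have mean: "expectation (\<lambda>\<omega>. u \<bullet> X \<omega>) = 0"
      by (rule normal_distributed_expectation[OF s D])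
    moreover have "integrable M (\<lambda>\<omega>. (u \<bullet> X \<omega>)\<^sup>2)"
      using distributed_integrable[OF D, of "\<lambda>x. x\<^sup>2"] integrable_normal_moment[OF s, of 0 2] by simp
    moreover have "expectation (\<lambda>\<omega>. (u \<bullet> X \<omega>)\<^sup>2) = ?v"
      using normal_distributed_variance[OF s D] psd[of u] by (simp add: mean)
    ultimately show ?thesis by blast
  qed
  then show "integrable M (\<lambda>\<omega>. u \<bullet> X \<omega>)" "expectation (\<lambda>\<omega>. u \<bullet> X \<omega>) = 0"
    "integrable M (\<lambda>\<omega>. (u \<bullet> X \<omega>)\<^sup>2)" "expectation (\<lambda>\<omega>. (u \<bullet> X \<omega>)\<^sup>2) = u \<bullet> (C *v u)"
    by blast+
qed

lemma (in prob_space) centered_gaussian_mean: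
  assumes X: "centered_gaussian M X C" and psd: "\<And>u. 0 \<le> u \<bullet> (C *v u)"
  shows "integrable M (\<lambda>\<omega>. X \<omega> $ j)" "expectation (\<lambda>\<omega>. X \<omega> $ j) = 0"
  using centered_gaussian_linear_moments(1,2)[OF assms, of "axis j 1"] by (simp_all add: inner_axis')

text \<open>Second moments of \<open>u \<bullet> X\<close> are known for every \<open>u\<close>; polarization with
  \<open>u = e\<^sub>j + e\<^sub>k\<close> and \<open>u = e\<^sub>j - e\<^sub>k\<close> recovers the mixed moments.\<close>

lemma (in prob_space) centered_gaussian_covariance:
  assumes X: "centered_gaussian M X C" and psd: "\<And>u. 0 \<le> u \<bullet> (C *v u)" and sym: "transpose C = C"
  shows "integrable M (\<lambda>\<omega>. X \<omega> $ j * X \<omega> $ k)" "expectation (\<lambda>\<omega>. X \<omega> $ j * X \<omega> $ k) = C $ j $ k"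
proof -
  note mom = centered_gaussian_linear_moments(3,4)[OF X psd]
  have *: "X \<omega> $ j * X \<omega> $ k = ((axis j 1 + axis k 1) \<bullet> X \<omega>)\<^sup>2 / 4 - ((axis j 1 - axis k 1) \<bullet> X \<omega>)\<^sup>2 / 4" for \<omega>
    by (simp add: inner_add_left inner_diff_left inner_axis' power2_eq_square field_simps)
  have ent: "axis p 1 \<bullet> (C *v axis q 1) = C $ p $ q" for p q
    by (simp add: inner_axis' matrix_vector_mul_component inner_axis)
  have "C $ k $ j = C $ j $ k"
    using sym by (metis transpose_def vec_lambda_beta)
  then have "C $ j $ k = (axis j 1 + axis k 1) \<bullet> (C *v (axis j 1 + axis k 1)) / 4
      - (axis j 1 - axis k 1) \<bullet> (C *v (axis j 1 - axis k 1)) / 4"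
    by (simp add: inner_add_left inner_diff_left inner_add_right inner_diff_right ent
        matrix_vector_right_distrib matrix_vector_mult_diff_distrib field_simps)
  then show "integrable M (\<lambda>\<omega>. X \<omega> $ j * X \<omega> $ k)" "expectation (\<lambda>\<omega>. X \<omega> $ j * X \<omega> $ k) = C $ j $ k"
    unfolding * using mom by simp_all
qed

section \<open>Recursions driven by independent noise\<close>

text \<open>Independence of two random variables, in the form of a product law. The predicate \<open>indep_var\<close>
  expresses the same notion for variables of one common type, but here a state and the noise that
  drives it take values in different types.\<close>

definition (in prob_space) indep_pair :: "'b measure \<Rightarrow> ('a \<Rightarrow> 'b) \<Rightarrow> 'c measure \<Rightarrow> ('a \<Rightarrow> 'c) \<Rightarrow> bool" where
  "indep_pair S X N Y \<longleftrightarrow> random_variable S X \<and> random_variable N Y \<and>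
     distr M S X \<Otimes>\<^sub>M distr M N Y = distr M (S \<Otimes>\<^sub>M N) (\<lambda>\<omega>. (X \<omega>, Y \<omega>))"

lemma (in prob_space) indep_var_iff_indep_pair: "indep_var S X N Y \<longleftrightarrow> indep_pair S X N Y"
  unfolding indep_pair_def by (rule indep_var_distribution_eq)

lemma (in prob_space) indep_pair_compose:
  assumes "indep_pair S X N Y" and f: "f \<in> measurable S S'" and g: "g \<in> measurable N N'"
  shows "indep_pair S' (\<lambda>\<omega>. f (X \<omega>)) N' (\<lambda>\<omega>. g (Y \<omega>))"
proof -
  have X: "random_variable S X" and Y: "random_variable N Y"
    and joint: "distr M S X \<Otimes>\<^sub>M distr M N Y = distr M (S \<Otimes>\<^sub>M N) (\<lambda>\<omega>. (X \<omega>, Y \<omega>))"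
    using assms(1) unfolding indep_pair_def by auto
  have fX: "random_variable S' (\<lambda>\<omega>. f (X \<omega>))" and gY: "random_variable N' (\<lambda>\<omega>. g (Y \<omega>))"
    using measurable_compose[OF X f] measurable_compose[OF Y g] .
  have fg: "(\<lambda>(x, y). (f x, g y)) \<in> measurable (S \<Otimes>\<^sub>M N) (S' \<Otimes>\<^sub>M N')"
    using f g by measurable
  have X_law: "distr M S' (\<lambda>\<omega>. f (X \<omega>)) = distr (distr M S X) S' f"
    using distr_distr[OF f X] by (simp add: comp_def)
  have Y_law: "distr M N' (\<lambda>\<omega>. g (Y \<omega>)) = distr (distr M N Y) N' g"
    using distr_distr[OF g Y] by (simp add: comp_def)
  have "sigma_finite_measure (distr (distr M N Y) N' g)"
    using prob_space.prob_space_distr[OF prob_space_axioms gY]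
    by (simp flip: Y_law add: prob_space_imp_sigma_finite)
  then have "distr M S' (\<lambda>\<omega>. f (X \<omega>)) \<Otimes>\<^sub>M distr M N' (\<lambda>\<omega>. g (Y \<omega>)) =
      distr (distr M S X \<Otimes>\<^sub>M distr M N Y) (S' \<Otimes>\<^sub>M N') (\<lambda>(x, y). (f x, g y))"
    unfolding X_law Y_law by (intro pair_measure_distr) (use f g in auto)
  also have "\<dots> = distr M (S' \<Otimes>\<^sub>M N') ((\<lambda>(x, y). (f x, g y)) \<circ> (\<lambda>\<omega>. (X \<omega>, Y \<omega>)))"
    unfolding joint by (rule distr_distr[OF fg measurable_Pair[OF X Y]])
  finally show ?thesis
    unfolding indep_pair_def using fX gY by (simp add: comp_def)
qed

text \<open>The state \<open>Z n\<close> is a measurable function of the noise variables before time \<open>n\<close>, so it is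
  independent of the noise at time \<open>n\<close>.\<close>

lemma (in prob_space) recursion_indep_noise:
  fixes H :: "nat \<Rightarrow> 'a \<Rightarrow> 'c"
  assumes H: "indep_vars (\<lambda>_. N) H {..n}"
    and init: "init \<in> space S"
    and G: "\<And>k. (\<lambda>(z, h). G k z h) \<in> measurable (S \<Otimes>\<^sub>M N) S"
    and Z0: "\<And>\<omega>. Z 0 \<omega> = init"
    and Z_Suc: "\<And>k \<omega>. Z (Suc k) \<omega> = G k (Z k \<omega>) (H k \<omega>)"
  shows "indep_pair S (Z n) N (H n)"
proof -
  \<comment> \<open>The state at time \<open>m\<close> as a function of the path of the noise.\<close>
  define F where "F m h = rec_nat init (\<lambda>k z. G k z (h k)) m" for m and h :: "nat \<Rightarrow> 'c"
  have Z_eq: "Z m \<omega> = F m (\<lambda>k\<in>{..<n}. H k \<omega>)" if "m \<le> n" for m \<omega>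
    using that by (induction m) (simp_all add: F_def Z0 Z_Suc)
  have F_meas: "F m \<in> measurable (PiM {..<n} (\<lambda>_. N)) S" if "m \<le> n" for m
    using that
  proof (induction m)
    case 0
    then show ?case by (simp add: F_def[abs_def] init)
  next
    case (Suc m)
    have "(\<lambda>h. (F m h, h m)) \<in> measurable (PiM {..<n} (\<lambda>_. N)) (S \<Otimes>\<^sub>M N)"
      using Suc by (intro measurable_Pair measurable_component_singleton) auto
    from measurable_compose[OF this G[of m]]
    have "(\<lambda>h. G m (F m h) (h m)) \<in> measurable (PiM {..<n} (\<lambda>_. N)) S"
      by simp
    moreover have "F (Suc m) = (\<lambda>h. G m (F m h) (h m))"
      by (simp add: fun_eq_iff F_def)
    ultimately show ?case by simp
  qed
  have "indep_var (PiM {..<n} (\<lambda>_. N)) (\<lambda>\<omega>. \<lambda>k\<in>{..<n}. H k \<omega>) (PiM {n} (\<lambda>_. N)) (\<lambda>\<omega>. \<lambda>k\<in>{n}. H k \<omega>)"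
    by (rule indep_var_restrict[OF H]) auto
  then have "indep_pair S (\<lambda>\<omega>. F n (\<lambda>k\<in>{..<n}. H k \<omega>)) N (\<lambda>\<omega>. (\<lambda>h. h n) (\<lambda>k\<in>{n}. H k \<omega>))"
    unfolding indep_var_iff_indep_pair
    by (rule indep_pair_compose) (auto intro: F_meas measurable_component_singleton)
  moreover have "(\<lambda>\<omega>. F n (\<lambda>k\<in>{..<n}. H k \<omega>)) = Z n"
    by (simp add: fun_eq_iff Z_eq)
  ultimately show ?thesis by simp
qed

text \<open>By independence, the law of \<open>Z (Suc n)\<close> is the image under \<open>G n\<close> of the product of the laws
  of \<open>Z n\<close> and \<open>H n\<close>. This allows the comparison of recursions on different probability spaces.\<close>

lemma recursion_law_unique:
  assumes M: "prob_space M" and M': "prob_space M'"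
    and H: "\<And>n. prob_space.indep_vars M (\<lambda>_. N) H {..n}"
    and H': "\<And>n. prob_space.indep_vars M' (\<lambda>_. N) H' {..n}"
    and law: "\<And>k. distr M N (H k) = distr M' N (H' k)"
    and init: "init \<in> space S"
    and G: "\<And>k. (\<lambda>(z, h). G k z h) \<in> measurable (S \<Otimes>\<^sub>M N) S"
    and Z0: "\<And>\<omega>. Z 0 \<omega> = init" and Z0': "\<And>\<omega>. Z' 0 \<omega> = init"
    and Z_Suc: "\<And>k \<omega>. Z (Suc k) \<omega> = G k (Z k \<omega>) (H k \<omega>)"
    and Z'_Suc: "\<And>k \<omega>. Z' (Suc k) \<omega> = G k (Z' k \<omega>) (H' k \<omega>)"
  shows "distr M S (Z n) = distr M' S (Z' n)"
proof (induction n)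
  case 0
  have "distr M S (\<lambda>_. init) = distr M' S (\<lambda>_. init)"
    using prob_space.distr_const[OF M init] prob_space.distr_const[OF M' init] by simp
  then show ?case by (simp add: Z0[abs_def] Z0'[abs_def])
next
  case (Suc n)
  have step: "distr R S (Y (Suc n)) = distr (distr R S (Y n) \<Otimes>\<^sub>M distr R N (h n)) S (\<lambda>(z, h). G n z h)"
    if R: "prob_space R" and h: "prob_space.indep_vars R (\<lambda>_. N) h {..n}"
      and Y0: "\<And>\<omega>. Y 0 \<omega> = init" and Y_Suc: "\<And>k \<omega>. Y (Suc k) \<omega> = G k (Y k \<omega>) (h k \<omega>)"
    for R :: "'x measure" and Y h
  proof -
    interpret R: prob_space R by (rule R)
    have ind: "R.indep_pair S (Y n) N (h n)"
      by (rule R.recursion_indep_noise[OF h init G Y0 Y_Suc])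
    then have rv: "Y n \<in> measurable R S" "h n \<in> measurable R N"
      unfolding R.indep_pair_def by auto
    have "distr R S (Y n) \<Otimes>\<^sub>M distr R N (h n) = distr R (S \<Otimes>\<^sub>M N) (\<lambda>\<omega>. (Y n \<omega>, h n \<omega>))"
      using ind unfolding R.indep_pair_def by blast
    also have "distr \<dots> S (\<lambda>(z, h). G n z h) = distr R S ((\<lambda>(z, h). G n z h) \<circ> (\<lambda>\<omega>. (Y n \<omega>, h n \<omega>)))"
      by (rule distr_distr[OF G measurable_Pair[OF rv]])
    finally show ?thesis by (simp add: comp_def Y_Suc[abs_def])
  qed
  show ?case
    using step[OF M H Z0 Z_Suc] step[OF M' H' Z0' Z'_Suc] Suc.IH law by simp
qed

lemma (in prob_space) indep_pair_centered_product:
  fixes Z :: "'a \<Rightarrow> 'b" and H :: "'a \<Rightarrow> 'c" and \<phi> :: "'b \<Rightarrow> real" and \<psi> :: "'c \<Rightarrow> real"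
  assumes ind: "indep_pair S Z N H"
    and meas: "\<phi> \<in> borel_measurable S" "\<psi> \<in> borel_measurable N"
    and int: "integrable M (\<lambda>\<omega>. \<phi> (Z \<omega>))" "integrable M (\<lambda>\<omega>. \<psi> (H \<omega>))"
    and centered: "expectation (\<lambda>\<omega>. \<psi> (H \<omega>)) = 0"
  shows "integrable M (\<lambda>\<omega>. \<phi> (Z \<omega>) * \<psi> (H \<omega>))" "expectation (\<lambda>\<omega>. \<phi> (Z \<omega>) * \<psi> (H \<omega>)) = 0"
proof -
  have "indep_var borel (\<lambda>\<omega>. \<phi> (Z \<omega>)) borel (\<lambda>\<omega>. \<psi> (H \<omega>))"
    unfolding indep_var_iff_indep_pair by (rule indep_pair_compose[OF ind meas])
  note indep_var_integrable[OF this int] indep_var_lebesgue_integral[OF this int]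
  then show "integrable M (\<lambda>\<omega>. \<phi> (Z \<omega>) * \<psi> (H \<omega>))" "expectation (\<lambda>\<omega>. \<phi> (Z \<omega>) * \<psi> (H \<omega>)) = 0"
    using centered by simp_all
qed

section \<open>Increments of Brownian motion\<close>

lemma full_incr_eq:
  "full_incr W T l n \<omega> = W (real n * step_size T (l - 1) + step_size T (l - 1)) \<omega> - W (real n * step_size T (l - 1)) \<omega>"
  by (simp add: full_incr_def half_incr_def grid_time_def algebra_simps)

lemma brownian_motion_indep_increments:
  assumes "brownian_motion M W \<Omega>" "0 \<le> \<tau> 0" "\<And>i. \<tau> i \<le> \<tau> (Suc i)"
  shows "prob_space.indep_vars M (\<lambda>_. borel) (\<lambda>i \<omega>. W (\<tau> (Suc i)) \<omega> - W (\<tau> i) \<omega>) {..<n}"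
  using assms unfolding brownian_motion_def by simp

lemma brownian_full_incr:
  assumes W: "brownian_motion M W \<Omega>" and s: "0 \<le> step_size T (l - 1)"
  shows "prob_space.indep_vars M (\<lambda>_. borel) (full_incr W T l) {..n}"
    and "centered_gaussian M (full_incr W T l n) (step_size T (l - 1) *\<^sub>R \<Omega>)"
proof -
  let ?s = "step_size T (l - 1)"
  define \<tau> where "\<tau> i = real i * ?s" for i
  have "0 \<le> \<tau> 0" "\<And>i. \<tau> i \<le> \<tau> (Suc i)"
    using s by (simp_all add: \<tau>_def mult_right_mono)
  then have "prob_space.indep_vars M (\<lambda>_. borel) (\<lambda>i \<omega>. W (\<tau> (Suc i)) \<omega> - W (\<tau> i) \<omega>) {..<Suc n}"
    by (rule brownian_motion_indep_increments[OF W])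
  moreover have "(\<lambda>i \<omega>. W (\<tau> (Suc i)) \<omega> - W (\<tau> i) \<omega>) = full_incr W T l"
    by (simp add: fun_eq_iff full_incr_eq \<tau>_def algebra_simps)
  ultimately show "prob_space.indep_vars M (\<lambda>_. borel) (full_incr W T l) {..n}"
    by (simp add: lessThan_Suc_atMost)
  have "centered_gaussian M (\<lambda>\<omega>. W (real n * ?s + ?s) \<omega> - W (real n * ?s) \<omega>) (?s *\<^sub>R \<Omega>)"
    using W s unfolding brownian_motion_def by simp
  then show "centered_gaussian M (full_incr W T l n) (?s *\<^sub>R \<Omega>)"
    by (simp add: full_incr_eq[abs_def])
qed

text \<open>On the grid of mesh \<open>\<Delta>t / 2\<close> the half increments of step \<open>n\<close> are the consecutive increments with the
  indices \<open>2 n\<close> and \<open>2 n + 1\<close>; grouping independent variables into disjoint blocks keeps the blocks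
  independent.\<close>

lemma brownian_half_incr:
  fixes \<Omega> :: "real^'m^'m::finite"
  assumes W: "brownian_motion M W \<Omega>" and s: "0 \<le> step_size T (l - 1)"
  shows "prob_space.indep_vars M (\<lambda>_. borel)
      (\<lambda>n \<omega>. (half_incr W T l (real n) \<omega>, half_incr W T l (real n + 1/2) \<omega>)) {..n}"
    and "prob_space.indep_var M borel (half_incr W T l (real n)) borel (half_incr W T l (real n + 1/2))"
    and "0 \<le> q \<Longrightarrow> centered_gaussian M (half_incr W T l q) ((step_size T (l - 1) / 2) *\<^sub>R \<Omega>)"
proof -
  interpret prob_space M using W unfolding brownian_motion_def by blast
  let ?s = "step_size T (l - 1)"
  define \<tau> where "\<tau> i = real i * (?s / 2)" for i
  define H where "H i \<omega> = W (\<tau> (Suc i)) \<omega> - W (\<tau> i) \<omega>" for i \<omega>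
  have grid: "grid_time T l (real n) = \<tau> (2 * n)" "grid_time T l (real n + 1/2) = \<tau> (Suc (2 * n))"
      "grid_time T l (real n + 1/2 + 1/2) = \<tau> (Suc (Suc (2 * n)))" for n
    by (simp_all add: grid_time_def \<tau>_def field_simps)
  have H_eq: "half_incr W T l (real n) = H (2 * n)" "half_incr W T l (real n + 1/2) = H (Suc (2 * n))" for n
    by (simp_all only: fun_eq_iff H_def half_incr_def grid simp_thms)
  have "0 \<le> \<tau> 0" "\<And>i. \<tau> i \<le> \<tau> (Suc i)"
    using s by (simp_all add: \<tau>_def mult_right_mono)
  then have ind: "indep_vars (\<lambda>_. borel) H {..<N}" for N
    unfolding H_def[abs_def] by (rule brownian_motion_indep_increments[OF W])
  have "indep_vars (\<lambda>k. PiM {2 * k, Suc (2 * k)} (\<lambda>_. borel)) (\<lambda>k \<omega>. \<lambda>i\<in>{2 * k, Suc (2 * k)}. H i \<omega>) {..n}"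
  proof (rule indep_vars_restrict[OF ind[of "2 * n + 2"]])
    have "{2 * i, Suc (2 * i)} \<inter> {2 * j, Suc (2 * j)} = {}" if "i \<noteq> j" for i j :: nat
    proof -
      have "2 * i \<noteq> 2 * j" "Suc (2 * i) \<noteq> 2 * j" "2 * i \<noteq> Suc (2 * j)"
        using that by presburger+
      then show ?thesis by simp
    qed
    then show "disjoint_family_on (\<lambda>k. {2 * k, Suc (2 * k)}) {..n}"
      by (simp add: disjoint_family_on_def)
  qed auto
  then have "indep_vars (\<lambda>_. borel) (\<lambda>k \<omega>. (\<lambda>h. (h (2 * k), h (Suc (2 * k)))) (\<lambda>i\<in>{2 * k, Suc (2 * k)}. H i \<omega>)) {..n}"
    by (rule indep_vars_compose2)
      (auto simp: borel_prod[symmetric] intro!: measurable_Pair measurable_component_singleton)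
  then show "indep_vars (\<lambda>_. borel)
      (\<lambda>n \<omega>. (half_incr W T l (real n) \<omega>, half_incr W T l (real n + 1/2) \<omega>)) {..n}"
    by (simp add: H_eq)
  have "indep_var (PiM {2 * n} (\<lambda>_. borel)) (\<lambda>\<omega>. \<lambda>i\<in>{2 * n}. H i \<omega>)
      (PiM {Suc (2 * n)} (\<lambda>_. borel)) (\<lambda>\<omega>. \<lambda>i\<in>{Suc (2 * n)}. H i \<omega>)"
    by (rule indep_var_restrict[OF ind[of "2 * n + 2"]]) auto
  then have "indep_var borel ((\<lambda>h. h (2 * n)) \<circ> (\<lambda>\<omega>. \<lambda>i\<in>{2 * n}. H i \<omega>))
      borel ((\<lambda>h. h (Suc (2 * n))) \<circ> (\<lambda>\<omega>. \<lambda>i\<in>{Suc (2 * n)}. H i \<omega>))"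
    by (rule indep_var_compose) (auto intro: measurable_component_singleton)
  then show "indep_var borel (half_incr W T l (real n)) borel (half_incr W T l (real n + 1/2))"
    by (simp add: comp_def H_eq)
  assume "0 \<le> q"
  then have "centered_gaussian M (\<lambda>\<omega>. W (q * ?s + ?s / 2) \<omega> - W (q * ?s) \<omega>) ((?s / 2) *\<^sub>R \<Omega>)"
    using W s unfolding brownian_motion_def by simp
  then show "centered_gaussian M (half_incr W T l q) ((?s / 2) *\<^sub>R \<Omega>)"
    by (simp add: half_incr_def[abs_def] grid_time_def algebra_simps)
qed

section \<open>Means of the two schemes\<close>

lemma fine_incr_nth:
  "fine_incr a b \<Omega> x t s w $ i = a i x t * s + (\<Sum>j\<in>UNIV. b i j x t * w $ j)
     + (\<Sum>j\<in>UNIV. \<Sum>k\<in>UNIV. h_coeff b i j k x t * (w $ j * w $ k - \<Omega> $ j $ k * s))"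
  by (simp add: fine_incr_def)

lemma coarse_incr_nth:
  "coarse_incr a b \<Omega> x\<^sub>1 x\<^sub>2 t s w w' $ i = a i x\<^sub>1 t * s + (\<Sum>j\<in>UNIV. b i j x\<^sub>2 t * (w + w') $ j)
     + (\<Sum>j\<in>UNIV. \<Sum>k\<in>UNIV. h_coeff b i j k x\<^sub>2 t *
         ((w + w') $ j * (w + w') $ k - \<Omega> $ j $ k * s - w $ j * w' $ k + w' $ j * w $ k))"
  by (simp add: coarse_incr_def Let_def)

context
  fixes a :: "'d::finite \<Rightarrow> real^'d \<Rightarrow> real \<Rightarrow> real"
    and b :: "'d \<Rightarrow> 'm::finite \<Rightarrow> real^'d \<Rightarrow> real \<Rightarrow> real"
    and \<Omega> :: "real^'m^'m" and S\<^sub>0 :: "real^'d" and T :: real and l :: nat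
  assumes T: "0 < T" and \<Omega>: "correlation_matrix \<Omega>"
    and a_reg: "\<And>i. bounded_first_derivs (a i)"
    and b_reg: "\<And>i j. bounded_first_derivs (b i j)"
    and h_reg: "\<And>i j k. bounded_first_derivs (h_coeff b i j k)"
begin

lemma step_nonneg: "0 \<le> step_size T (l - 1)"
  using T by (simp add: step_size_def)

lemma grid_nonneg: "0 \<le> grid_time T l (real n)"
  using step_nonneg by (simp add: grid_time_def)

lemma scaled_correlation:
  assumes "0 \<le> c"
  shows "0 \<le> u \<bullet> ((c *\<^sub>R \<Omega>) *v u)" "transpose (c *\<^sub>R \<Omega>) = c *\<^sub>R \<Omega>"
  using assms \<Omega>
  by (auto simp: correlation_matrix_def scaleR_matrix_vector_assoc[symmetric] transpose_def vec_eq_iff)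

lemmas coeff_measurable =
  a_reg[THEN bounded_first_derivs_measurable, OF grid_nonneg]
  b_reg[THEN bounded_first_derivs_measurable, OF grid_nonneg]
  h_reg[THEN bounded_first_derivs_measurable, OF grid_nonneg]

lemma fine_step_measurable:
  "(\<lambda>(x, w). x + fine_incr a b \<Omega> x (grid_time T l (real k)) (step_size T (l - 1)) w)
     \<in> borel_measurable (borel \<Otimes>\<^sub>M borel)"
proof (rule borel_measurable_vecI)
  fix i
  note [measurable] = coeff_measurable borel_measurable_vec_nth
  show "(\<lambda>\<omega>. (case \<omega> of (x, w) \<Rightarrow> x + fine_incr a b \<Omega> x (grid_time T l (real k)) (step_size T (l - 1)) w) $ i)
      \<in> borel_measurable (borel \<Otimes>\<^sub>M borel)"
    by (simp add: case_prod_beta fine_incr_nth) measurable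
qed

text \<open>The coarse scheme is not a recursion by itself, since its drift is evaluated at the fine state.
  The pair of both states is one, driven by the pair of half increments.\<close>

lemma coarse_step_measurable:
  "(\<lambda>(z, h).
      (fst z + fine_incr a b \<Omega> (fst z) (grid_time T l (real k)) (step_size T (l - 1)) (fst h + snd h),
       snd z + coarse_incr a b \<Omega> (fst z) (snd z) (grid_time T l (real k)) (step_size T (l - 1)) (fst h) (snd h)))
     \<in> measurable ((borel \<Otimes>\<^sub>M borel) \<Otimes>\<^sub>M (borel \<Otimes>\<^sub>M borel)) (borel \<Otimes>\<^sub>M borel)"
proof -
  note [measurable] = coeff_measurable borel_measurable_vec_nth
  have "(\<lambda>p. fst (fst p) + fine_incr a b \<Omega> (fst (fst p)) (grid_time T l (real k)) (step_size T (l - 1))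
        (fst (snd p) + snd (snd p))) \<in> borel_measurable ((borel \<Otimes>\<^sub>M borel) \<Otimes>\<^sub>M (borel \<Otimes>\<^sub>M borel))"
    by (rule borel_measurable_vecI) (simp add: fine_incr_nth, measurable)
  moreover have "(\<lambda>p. snd (fst p) + coarse_incr a b \<Omega> (fst (fst p)) (snd (fst p)) (grid_time T l (real k))
        (step_size T (l - 1)) (fst (snd p)) (snd (snd p))) \<in> borel_measurable ((borel \<Otimes>\<^sub>M borel) \<Otimes>\<^sub>M (borel \<Otimes>\<^sub>M borel))"
    by (rule borel_measurable_vecI) (simp add: coarse_incr_nth, measurable)
  ultimately show ?thesis
    unfolding case_prod_beta by (rule measurable_Pair)
qed

lemma fine_indep_noise:
  assumes W: "brownian_motion M W \<Omega>"
  shows "prob_space.indep_pair M borel (S_fine a b \<Omega> S\<^sub>0 T l W n) borel (full_incr W T l n)"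
proof -
  interpret prob_space M using W unfolding brownian_motion_def by simp
  show ?thesis
    by (rule recursion_indep_noise[OF brownian_full_incr(1)[OF W step_nonneg], of S\<^sub>0, OF _ fine_step_measurable]) simp_all
qed

lemma coarse_indep_noise:
  assumes W: "brownian_motion M W \<Omega>"
  shows "prob_space.indep_pair M (borel \<Otimes>\<^sub>M borel) (\<lambda>\<omega>. (S_fine a b \<Omega> S\<^sub>0 T l W n \<omega>, S_coarse a b \<Omega> S\<^sub>0 T l W n \<omega>))
      (borel \<Otimes>\<^sub>M borel) (\<lambda>\<omega>. (half_incr W T l (real n) \<omega>, half_incr W T l (real n + 1/2) \<omega>))"
proof -
  interpret prob_space M using W unfolding brownian_motion_def by simp
  have H: "indep_vars (\<lambda>_. borel \<Otimes>\<^sub>M borel)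
      (\<lambda>n \<omega>. (half_incr W T l (real n) \<omega>, half_incr W T l (real n + 1/2) \<omega>)) {..n}"
    unfolding borel_prod by (rule brownian_half_incr(1)[OF W step_nonneg])
  show ?thesis
    by (rule recursion_indep_noise[OF H, of "(S\<^sub>0, S\<^sub>0)", OF _ coarse_step_measurable])
      (simp_all add: space_pair_measure full_incr_def)
qed

lemma fine_law_unique:
  assumes W: "brownian_motion M W \<Omega>" and W': "brownian_motion M' W' \<Omega>"
  shows "distr M borel (S_fine a b \<Omega> S\<^sub>0 T l W n) = distr M' borel (S_fine a b \<Omega> S\<^sub>0 T l W' n)"
proof (rule recursion_law_unique[where N = borel and init = S\<^sub>0 and H = "full_incr W T l" and H' = "full_incr W' T l"
      and G = "\<lambda>k x w. x + fine_incr a b \<Omega> x (grid_time T l (real k)) (step_size T (l - 1)) w"])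
  show "prob_space.indep_vars M (\<lambda>_. borel) (full_incr W T l) {..n}"
    "prob_space.indep_vars M' (\<lambda>_. borel) (full_incr W' T l) {..n}" for n
    by (rule brownian_full_incr(1)[OF _ step_nonneg], fact)+
  show M: "prob_space M" and M': "prob_space M'"
    using W W' unfolding brownian_motion_def by simp_all
  show "distr M borel (full_incr W T l k) = distr M' borel (full_incr W' T l k)" for k
    by (rule centered_gaussian_law_unique[OF M M' brownian_full_incr(2)[OF W step_nonneg]
          brownian_full_incr(2)[OF W' step_nonneg]])
qed (rule fine_step_measurable | simp)+

text \<open>The noise terms of the fine scheme, including the compensated products
  \<open>v\<^sub>j v\<^sub>k - \<Omega>\<^sub>j\<^sub>k s\<close>, are centered because \<open>v\<close> has covariance \<open>s \<Omega>\<close>.\<close>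

lemma full_incr_moments:
  fixes n :: nat
  assumes W: "brownian_motion M W \<Omega>"
  defines "v \<equiv> full_incr W T l n"
  shows "integrable M (\<lambda>\<omega>. v \<omega> $ j)" "(\<integral>\<omega>. v \<omega> $ j \<partial>M) = 0"
    and "integrable M (\<lambda>\<omega>. v \<omega> $ j * v \<omega> $ k - \<Omega> $ j $ k * step_size T (l - 1))"
    and "(\<integral>\<omega>. v \<omega> $ j * v \<omega> $ k - \<Omega> $ j $ k * step_size T (l - 1) \<partial>M) = 0"
proof -
  interpret prob_space M using W unfolding brownian_motion_def by simp
  note g = brownian_full_incr(2)[OF W step_nonneg, of n, folded v_def]
  note mean = centered_gaussian_mean[OF g scaled_correlation(1)[OF step_nonneg]]
  note cov = centered_gaussian_covariance[OF g scaled_correlation(1)[OF step_nonneg] scaled_correlation(2)[OF step_nonneg]]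
  show "integrable M (\<lambda>\<omega>. v \<omega> $ j)" "(\<integral>\<omega>. v \<omega> $ j \<partial>M) = 0"
    by (rule mean)+
  show "integrable M (\<lambda>\<omega>. v \<omega> $ j * v \<omega> $ k - \<Omega> $ j $ k * step_size T (l - 1))"
    "(\<integral>\<omega>. v \<omega> $ j * v \<omega> $ k - \<Omega> $ j $ k * step_size T (l - 1) \<partial>M) = 0"
    using cov[of j k] by (simp_all add: prob_space)
qed

text \<open>The two halves of a step are independent and centered. This is why the antithetic terms
  \<open>- w\<^sub>j w'\<^sub>k + w'\<^sub>j w\<^sub>k\<close> of the coarse scheme do not contribute to its mean.\<close>

lemma half_incr_cross_moments:
  fixes n :: nat
  assumes W: "brownian_motion M W \<Omega>"
  defines "w \<equiv> half_incr W T l (real n)" and "w' \<equiv> half_incr W T l (real n + 1/2)"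
  shows "integrable M (\<lambda>\<omega>. w \<omega> $ j * w' \<omega> $ k)" "(\<integral>\<omega>. w \<omega> $ j * w' \<omega> $ k \<partial>M) = 0"
proof -
  interpret prob_space M using W unfolding brownian_motion_def by simp
  have half: "0 \<le> step_size T (l - 1) / 2" using step_nonneg by simp
  have g: "centered_gaussian M w ((step_size T (l - 1) / 2) *\<^sub>R \<Omega>)"
    "centered_gaussian M w' ((step_size T (l - 1) / 2) *\<^sub>R \<Omega>)"
    unfolding w_def w'_def by (rule brownian_half_incr(3)[OF W step_nonneg]; simp)+
  have "indep_pair borel w borel w'"
    unfolding w_def w'_def indep_var_iff_indep_pair[symmetric] by (rule brownian_half_incr(2)[OF W step_nonneg])
  from indep_pair_centered_product[OF this borel_measurable_vec_nth borel_measurable_vec_nth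
      centered_gaussian_mean(1)[OF g(1) scaled_correlation(1)[OF half]]
      centered_gaussian_mean[OF g(2) scaled_correlation(1)[OF half]]]
  show "integrable M (\<lambda>\<omega>. w \<omega> $ j * w' \<omega> $ k)" "(\<integral>\<omega>. w \<omega> $ j * w' \<omega> $ k \<partial>M) = 0" .
qed

lemma fine_step_mean:
  assumes W: "brownian_motion M W \<Omega>"
    and int: "integrable M (S_fine a b \<Omega> S\<^sub>0 T l W n)"
  shows "integrable M (S_fine a b \<Omega> S\<^sub>0 T l W (Suc n))"
    and "(\<integral>\<omega>. S_fine a b \<Omega> S\<^sub>0 T l W (Suc n) \<omega> \<partial>M) $ i = (\<integral>\<omega>. S_fine a b \<Omega> S\<^sub>0 T l W n \<omega> \<partial>M) $ i
      + (\<integral>\<omega>. a i (S_fine a b \<Omega> S\<^sub>0 T l W n \<omega>) (grid_time T l (real n)) \<partial>M) * step_size T (l - 1)"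
proof -
  interpret prob_space M using W unfolding brownian_motion_def by simp
  let ?S = "S_fine a b \<Omega> S\<^sub>0 T l W n" and ?v = "full_incr W T l n"
  let ?t = "grid_time T l (real n)" and ?s = "step_size T (l - 1)"
  note comp = borel_measurable_integrable[OF int] integrable_vec_nth[OF int]
  have a_int: "integrable M (\<lambda>\<omega>. a i (?S \<omega>) ?t)" for i
    by (rule bounded_first_derivs_integrable[OF a_reg grid_nonneg comp])
  have b_int: "integrable M (\<lambda>\<omega>. b i j (?S \<omega>) ?t)" for i j
    by (rule bounded_first_derivs_integrable[OF b_reg grid_nonneg comp])
  have h_int: "integrable M (\<lambda>\<omega>. h_coeff b i j k (?S \<omega>) ?t)" for i j k
    by (rule bounded_first_derivs_integrable[OF h_reg grid_nonneg comp])
  note [measurable] = borel_measurable_vec_nth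
  have b_mean: "integrable M (\<lambda>\<omega>. b i j (?S \<omega>) ?t * ?v \<omega> $ j)" "expectation (\<lambda>\<omega>. b i j (?S \<omega>) ?t * ?v \<omega> $ j) = 0" for i j
    by (rule indep_pair_centered_product[OF fine_indep_noise[OF W] coeff_measurable(2) borel_measurable_vec_nth
          b_int full_incr_moments(1,2)[OF W]])+
  have h_mean: "integrable M (\<lambda>\<omega>. h_coeff b i j k (?S \<omega>) ?t * (?v \<omega> $ j * ?v \<omega> $ k - \<Omega> $ j $ k * ?s))"
    "expectation (\<lambda>\<omega>. h_coeff b i j k (?S \<omega>) ?t * (?v \<omega> $ j * ?v \<omega> $ k - \<Omega> $ j $ k * ?s)) = 0" for i j k
    by (rule indep_pair_centered_product[where \<psi> = "\<lambda>w. w $ j * w $ k - \<Omega> $ j $ k * ?s",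
          OF fine_indep_noise[OF W] coeff_measurable(3) _ h_int full_incr_moments(3,4)[OF W]], measurable)+
  note parts = a_int b_mean(1) h_mean(1) comp(2)
  show int': "integrable M (S_fine a b \<Omega> S\<^sub>0 T l W (Suc n))"
    by (rule integrable_vecI) (use parts in \<open>simp add: fine_incr_nth\<close>)
  show "(\<integral>\<omega>. S_fine a b \<Omega> S\<^sub>0 T l W (Suc n) \<omega> \<partial>M) $ i = (\<integral>\<omega>. ?S \<omega> \<partial>M) $ i + expectation (\<lambda>\<omega>. a i (?S \<omega>) ?t) * ?s"
    unfolding integral_vec_nth[OF int'] integral_vec_nth[OF int]
    using parts b_mean(2) h_mean(2) by (simp add: fine_incr_nth)
qed

text \<open>The mean increment is the mean drift at the fine state, exactly as in \<open>fine_step_mean\<close>: every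
  other term is a function of the coarse state times an independent centered factor. First moments
  of the state suffice, because independence makes these products integrable.\<close>

lemma coarse_step_mean:
  assumes W: "brownian_motion M W \<Omega>"
    and intS: "integrable M (S_fine a b \<Omega> S\<^sub>0 T l W n)"
    and int: "integrable M (S_coarse a b \<Omega> S\<^sub>0 T l W n)"
  shows "integrable M (S_coarse a b \<Omega> S\<^sub>0 T l W (Suc n))"
    and "(\<integral>\<omega>. S_coarse a b \<Omega> S\<^sub>0 T l W (Suc n) \<omega> \<partial>M) $ i = (\<integral>\<omega>. S_coarse a b \<Omega> S\<^sub>0 T l W n \<omega> \<partial>M) $ i
      + (\<integral>\<omega>. a i (S_fine a b \<Omega> S\<^sub>0 T l W n \<omega>) (grid_time T l (real n)) \<partial>M) * step_size T (l - 1)"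
proof -
  interpret prob_space M using W unfolding brownian_motion_def by simp
  let ?S = "S_fine a b \<Omega> S\<^sub>0 T l W n" and ?C = "S_coarse a b \<Omega> S\<^sub>0 T l W n"
  let ?w = "half_incr W T l (real n)" and ?w' = "half_incr W T l (real n + 1/2)"
  let ?t = "grid_time T l (real n)" and ?s = "step_size T (l - 1)"
  let ?\<psi> = "\<lambda>j k (w :: real^'m, w'). (w + w') $ j * (w + w') $ k - \<Omega> $ j $ k * ?s - w $ j * w' $ k + w' $ j * w $ k"
  note comp = borel_measurable_integrable[OF int] integrable_vec_nth[OF int]
  have a_int: "integrable M (\<lambda>\<omega>. a i (?S \<omega>) ?t)" for i
    by (rule bounded_first_derivs_integrable[OF a_reg grid_nonneg borel_measurable_integrable[OF intS] integrable_vec_nth[OF intS]])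
  have b_int: "integrable M (\<lambda>\<omega>. b i j (?C \<omega>) ?t)" for i j
    by (rule bounded_first_derivs_integrable[OF b_reg grid_nonneg comp])
  have h_int: "integrable M (\<lambda>\<omega>. h_coeff b i j k (?C \<omega>) ?t)" for i j k
    by (rule bounded_first_derivs_integrable[OF h_reg grid_nonneg comp])
  note [measurable] = borel_measurable_vec_nth
  have ind: "indep_pair borel ?C (borel \<Otimes>\<^sub>M borel) (\<lambda>\<omega>. (?w \<omega>, ?w' \<omega>))"
    using indep_pair_compose[OF coarse_indep_noise[OF W] measurable_snd measurable_ident] by simp
  have b_mean: "integrable M (\<lambda>\<omega>. b i j (?C \<omega>) ?t * (?w \<omega> + ?w' \<omega>) $ j)"
    "expectation (\<lambda>\<omega>. b i j (?C \<omega>) ?t * (?w \<omega> + ?w' \<omega>) $ j) = 0" for i j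
  proof -
    have m: "(\<lambda>(w, w'). (w + w') $ j) \<in> borel_measurable (borel \<Otimes>\<^sub>M borel :: ((real^'m) \<times> (real^'m)) measure)"
      by measurable
    \<comment> \<open>The two halves add up to the full increment of the step.\<close>
    from indep_pair_centered_product[OF ind coeff_measurable(2) m b_int] full_incr_moments(1,2)[OF W, of n j]
    show "integrable M (\<lambda>\<omega>. b i j (?C \<omega>) ?t * (?w \<omega> + ?w' \<omega>) $ j)"
      "expectation (\<lambda>\<omega>. b i j (?C \<omega>) ?t * (?w \<omega> + ?w' \<omega>) $ j) = 0"
      by (simp_all add: full_incr_def)
  qed
  have h_mean: "integrable M (\<lambda>\<omega>. h_coeff b i j k (?C \<omega>) ?t * ?\<psi> j k (?w \<omega>, ?w' \<omega>))"
    "expectation (\<lambda>\<omega>. h_coeff b i j k (?C \<omega>) ?t * ?\<psi> j k (?w \<omega>, ?w' \<omega>)) = 0" for i j k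
  proof -
    have m: "?\<psi> j k \<in> borel_measurable (borel \<Otimes>\<^sub>M borel)"
      by measurable
    have i: "integrable M (\<lambda>\<omega>. ?\<psi> j k (?w \<omega>, ?w' \<omega>))" "expectation (\<lambda>\<omega>. ?\<psi> j k (?w \<omega>, ?w' \<omega>)) = 0"
      using full_incr_moments(3,4)[OF W, of n j k] half_incr_cross_moments[OF W, of n j k]
        half_incr_cross_moments[OF W, of n k j]
      by (simp_all add: full_incr_def[abs_def] mult.commute[of "?w' _ $ j"])
    show "integrable M (\<lambda>\<omega>. h_coeff b i j k (?C \<omega>) ?t * ?\<psi> j k (?w \<omega>, ?w' \<omega>))"
      "expectation (\<lambda>\<omega>. h_coeff b i j k (?C \<omega>) ?t * ?\<psi> j k (?w \<omega>, ?w' \<omega>)) = 0"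
      by (rule indep_pair_centered_product[OF ind coeff_measurable(3) m h_int i])+
  qed
  note parts = a_int b_mean(1) h_mean(1)[unfolded prod.case] comp(2)
  have S_Suc: "S_coarse a b \<Omega> S\<^sub>0 T l W (Suc n) \<omega> $ i = ?C \<omega> $ i + (a i (?S \<omega>) ?t * ?s
      + (\<Sum>j\<in>UNIV. b i j (?C \<omega>) ?t * (?w \<omega> + ?w' \<omega>) $ j)
      + (\<Sum>j\<in>UNIV. \<Sum>k\<in>UNIV. h_coeff b i j k (?C \<omega>) ?t * ?\<psi> j k (?w \<omega>, ?w' \<omega>)))" for \<omega> i
    by (simp only: S_coarse.simps vector_add_component[of "?C \<omega>"] coarse_incr_nth prod.case)
  show int': "integrable M (S_coarse a b \<Omega> S\<^sub>0 T l W (Suc n))"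
    by (rule integrable_vecI, unfold S_Suc)
      (intro Bochner_Integration.integrable_add Bochner_Integration.integrable_sum integrable_mult_left
        a_int b_mean(1) h_mean(1) comp(2))
  show "(\<integral>\<omega>. S_coarse a b \<Omega> S\<^sub>0 T l W (Suc n) \<omega> \<partial>M) $ i = (\<integral>\<omega>. ?C \<omega> \<partial>M) $ i + expectation (\<lambda>\<omega>. a i (?S \<omega>) ?t) * ?s"
    unfolding integral_vec_nth[OF int'] integral_vec_nth[OF int] S_Suc
    by (simp only: Bochner_Integration.integral_add Bochner_Integration.integral_sum
        Bochner_Integration.integrable_add Bochner_Integration.integrable_sum integrable_mult_left integral_mult_left_zero
        a_int b_mean h_mean comp(2) sum.neutral_const add_0_right)
qed

lemma coarse_mean_eq_fine_mean:
  assumes W: "brownian_motion M W \<Omega>"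
  shows "integrable M (S_fine a b \<Omega> S\<^sub>0 T l W n) \<and> integrable M (S_coarse a b \<Omega> S\<^sub>0 T l W n) \<and>
    (\<integral>\<omega>. S_fine a b \<Omega> S\<^sub>0 T l W n \<omega> \<partial>M) = (\<integral>\<omega>. S_coarse a b \<Omega> S\<^sub>0 T l W n \<omega> \<partial>M)"
proof (induction n)
  case 0
  interpret prob_space M using W unfolding brownian_motion_def by simp
  show ?case by simp
next
  case (Suc n)
  note S = fine_step_mean[OF W] and C = coarse_step_mean[OF W]
  have "(\<integral>\<omega>. S_fine a b \<Omega> S\<^sub>0 T l W (Suc n) \<omega> \<partial>M) = (\<integral>\<omega>. S_coarse a b \<Omega> S\<^sub>0 T l W (Suc n) \<omega> \<partial>M)"
    unfolding vec_eq_iff using S(2)[of n] C(2)[of n] Suc.IH by metis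
  then show ?case using S(1)[of n] C(1)[of n] Suc.IH by blast
qed

end

theorem theorem4p1:
  fixes a :: "'d::finite \<Rightarrow> real^'d \<Rightarrow> real \<Rightarrow> real"
    and b :: "'d \<Rightarrow> 'm::finite \<Rightarrow> real^'d \<Rightarrow> real \<Rightarrow> real"
    and \<Omega> :: "real^'m^'m"
    and S\<^sub>0 :: "real^'d"
    and T :: real and l n :: nat
    and M :: "'a measure" and W :: "real \<Rightarrow> 'a \<Rightarrow> real^'m"
    and M' :: "'b measure" and W' :: "real \<Rightarrow> 'b \<Rightarrow> real^'m"
  assumes "T > 0" and "l \<ge> 1"
    and "correlation_matrix \<Omega>"
    and "brownian_motion M W \<Omega>"
    and "brownian_motion M' W' \<Omega>"
    and "\<And>i. bounded_first_derivs (a i)"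
    and "\<And>i j. bounded_first_derivs (b i j)"
    and "\<And>i j k. bounded_first_derivs (h_coeff b i j k)"
  shows "integrable M' (S_fine a b \<Omega> S\<^sub>0 T l W' n) \<and>
         integrable M (S_coarse a b \<Omega> S\<^sub>0 T l W n) \<and>
         (\<integral>\<omega>. S_fine a b \<Omega> S\<^sub>0 T l W' n \<omega> \<partial>M') = (\<integral>\<omega>. S_coarse a b \<Omega> S\<^sub>0 T l W n \<omega> \<partial>M)"
proof -
  note reg = assms(1,3,6,7,8)
  have M: "integrable M (S_fine a b \<Omega> S\<^sub>0 T l W n)" "integrable M (S_coarse a b \<Omega> S\<^sub>0 T l W n)"
    "(\<integral>\<omega>. S_fine a b \<Omega> S\<^sub>0 T l W n \<omega> \<partial>M) = (\<integral>\<omega>. S_coarse a b \<Omega> S\<^sub>0 T l W n \<omega> \<partial>M)"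
    using coarse_mean_eq_fine_mean[where a = a and b = b, OF reg assms(4)] by blast+
  have M': "integrable M' (S_fine a b \<Omega> S\<^sub>0 T l W' n)"
    using coarse_mean_eq_fine_mean[where a = a and b = b, OF reg assms(5)] by blast
  have "(\<integral>\<omega>. S_fine a b \<Omega> S\<^sub>0 T l W' n \<omega> \<partial>M') = (\<integral>x. x \<partial>distr M' borel (S_fine a b \<Omega> S\<^sub>0 T l W' n))"
    by (simp add: integral_distr borel_measurable_integrable[OF M'])
  also have "\<dots> = (\<integral>x. x \<partial>distr M borel (S_fine a b \<Omega> S\<^sub>0 T l W n))"
    using fine_law_unique[where a = a and b = b, OF reg assms(5,4)] by simp
  also have "\<dots> = (\<integral>\<omega>. S_fine a b \<Omega> S\<^sub>0 T l W n \<omega> \<partial>M)"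
    by (simp add: integral_distr borel_measurable_integrable[OF M(1)])
  finally show ?thesis
    using M M' by simp
qed

end
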